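(* Let $S=(1,1,2,2,2,\ldots)$, i.e. $a_1=a_2=1$ and $a_i=2$ for all $i\geq 3$, and let $n\geq 3$. Then $$\chi_S''(C_n)=\begin{cases}4, & n\notin\{4,7\},\\ 5, & n=7,\\ 6, & n=4.\end{cases}$$
   Context: $C_n$ is the cycle on $n$ vertices. For vertices $u,v$ of a graph $G$, $d(u,v)$ is the usual shortest-path distance. For a vertex $u$ and an edge $ab$, $d(u,ab)=d(ab,u)=\min\{d(u,a),d(u,b)\}+1$. For two distinct edges $ab,cd$, $d(ab,cd)=\min\{d(a,c),d(a,d),d(b,c),d(b,d)\}+1$. For a non-decreasing infinite sequence $S=(a_1,a_2,\ldots)$ of positive integers, an $S$-packing total coloring of $G$ using $k$ colors is a map $c:V(G)\cup E(G)\to\{1,\ldots,k\}$ such that any two distinct elements $A,B\in V(G)\cup E(G)$ with $c(A)=c(B)=i$ satisfy $d(A,B)>a_i$. The $S$-packing total chromatic number $\chi_S''(G)$ is the smallest $k$ for which one exists. *)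

theory Defs
  imports Complex_Main "HOL-Library.Extended_Nat"
begin

text \<open>A simple graph is given by its vertex set \<open>V\<close> and its set \<open>E\<close> of edges, which are
  two-element subsets of \<open>V\<close>.\<close>

definition simple_graph :: "'a set \<Rightarrow> 'a set set \<Rightarrow> bool" where
  "simple_graph V E \<longleftrightarrow> finite V \<and> (\<forall>e\<in>E. e \<subseteq> V \<and> card e = 2)"

definition is_path :: "'a set \<Rightarrow> 'a set set \<Rightarrow> 'a \<Rightarrow> 'a list \<Rightarrow> 'a \<Rightarrow> bool" where
  "is_path V E u p v \<longleftrightarrow>
     p \<noteq> [] \<and> hd p = u \<and> last p = v \<and> set p \<subseteq> V \<and> distinct p \<and>
     successively (\<lambda>x y. {x, y} \<in> E) p"

text \<open>The distance is \<open>\<infinity>\<close> if no path connects the two vertices.\<close>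

definition vdist :: "'a set \<Rightarrow> 'a set set \<Rightarrow> 'a \<Rightarrow> 'a \<Rightarrow> enat" where
  "vdist V E u v = (INF p \<in> {p. is_path V E u p v}. enat (length p - 1))"

text \<open>Elements of \<open>V \<union> E\<close> are represented in the disjoint sum \<open>V <+> E\<close>. In the edge-edge case
  the formula is meant for distinct edges; it is never used for equal ones below.\<close>

fun tdist :: "'a set \<Rightarrow> 'a set set \<Rightarrow> 'a + 'a set \<Rightarrow> 'a + 'a set \<Rightarrow> enat" where
  "tdist V E (Inl u) (Inl v) = vdist V E u v"
| "tdist V E (Inl u) (Inr e) = (INF a\<in>e. vdist V E u a) + 1"
| "tdist V E (Inr e) (Inl u) = (INF a\<in>e. vdist V E u a) + 1"
| "tdist V E (Inr e) (Inr f) = (INF a\<in>e. INF b\<in>f. vdist V E a b) + 1"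

text \<open>Sequences are indexed from 1; the value at 0 is irrelevant.\<close>

definition packing_sequence :: "(nat \<Rightarrow> nat) \<Rightarrow> bool" where
  "packing_sequence S \<longleftrightarrow> (\<forall>i\<ge>1. S i \<ge> 1) \<and> mono_on {1..} S"

definition packing_total_coloring ::
    "(nat \<Rightarrow> nat) \<Rightarrow> 'a set \<Rightarrow> 'a set set \<Rightarrow> nat \<Rightarrow> ('a + 'a set \<Rightarrow> nat) \<Rightarrow> bool" where
  "packing_total_coloring S V E k c \<longleftrightarrow>
     (\<forall>A \<in> V <+> E. c A \<in> {1..k}) \<and>
     (\<forall>A \<in> V <+> E. \<forall>B \<in> V <+> E. A \<noteq> B \<and> c A = c B \<longrightarrow> tdist V E A B > enat (S (c A)))"

text \<open>The value is \<open>\<infinity>\<close> if no number of colors suffices; otherwise the infimum is a minimum.\<close>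

definition packing_total_chromatic_number ::
    "(nat \<Rightarrow> nat) \<Rightarrow> 'a set \<Rightarrow> 'a set set \<Rightarrow> enat" where
  "packing_total_chromatic_number S V E =
     (INF k \<in> {k. \<exists>c. packing_total_coloring S V E k c}. enat k)"

text \<open>The cycle on \<open>n\<close> vertices, for \<open>n \<ge> 3\<close>.\<close>

definition cycle_verts :: "nat \<Rightarrow> nat set" where
  "cycle_verts n = {..<n}"

definition cycle_edges :: "nat \<Rightarrow> nat set set" where
  "cycle_edges n = {{i, (i + 1) mod n} | i. i < n}"

lemma simple_graph_cycle:
  assumes "n \<ge> 3"
  shows "simple_graph (cycle_verts n) (cycle_edges n)"
proof -
  have "i \<noteq> Suc i mod n" if "i < n" for i
    using that assms by (cases "Suc i = n") auto
  then show ?thesis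
    using assms by (auto simp: simple_graph_def cycle_verts_def cycle_edges_def card_2_iff)
qed

lemma packing_sequence_1122:
  assumes "S 1 = 1" and "S 2 = 1" and "\<And>i. i \<ge> 3 \<Longrightarrow> S i = 2"
  shows "packing_sequence S"
proof -
  have "S i = (if i \<le> 2 then 1 else 2)" if "i \<ge> 1" for i
  proof -
    consider "i = 1" | "i = 2" | "i \<ge> 3" using \<open>i \<ge> 1\<close> by linarith
    then show ?thesis using assms by cases auto
  qed
  then show ?thesis
    by (auto simp: packing_sequence_def intro!: mono_onI)
qed

end

theory Submission
  imports Defs
begin

text \<open>Walking once around \<open>C\<^sub>n\<close>, vertices and edges alternate. Numbering the \<open>2n\<close> elements in this
  order, the distance of two elements is half of their distance along the cycle \<open>\<int>/2n\<close>, rounded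
  up (\<open>tdist_cycle_elem\<close>). So the problem is one about coloring \<open>N = 2n\<close> points on a circle: two
  points of color 1, or of color 2, must be at least 3 steps apart, and two points of the same
  color from 3 on must be at least 5 steps apart (\<open>ex_packing_total_coloring_cycle_iff\<close>).

  The lower bound is a count. At most \<open>N div g\<close> points of a circle of length \<open>N \<ge> g\<close> can be
  pairwise at least \<open>g\<close> apart (\<open>card_spread_le\<close>), so \<open>k\<close> colors cover at most
  \<open>2 (N div 3) + (k - 2) (N div 5)\<close> points (\<open>length_le_of_cyclic_coloring\<close>). Three colors cover
  at most \<open>13 N / 15\<close> points, which is never enough. For \<open>n = 4\<close> five colors cover at most 7 of the
  8 points, and for \<open>n = 7\<close> four colors cover at most 12 of the 14 points.

  For the upper bound, the blocks 123124 and 1231421324 of lengths 6 and 10 can be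
  concatenated in any order, also cyclically: no constraint reaches further than 4 steps, both
  blocks begin with 1231, and each of them followed by 1231 is conflict-free
  (\<open>spaced_blocks\<close>). Hence four colors suffice if \<open>n = 3a + 5b\<close> for some \<open>a, b\<close>, and 4 and 7
  are the only \<open>n \<ge> 3\<close> not of this form (\<open>cyclic_4_coloring\<close>). These two cases are settled
  by the words 12312456 and 12312412512345.\<close>

section \<open>Distances in the cycle\<close>

text \<open>The distance of the points \<open>i, j < N\<close> on a circle of \<open>N\<close> points. The term
  \<open>max i j - min i j\<close> is \<open>\<bar>i - j\<bar>\<close>, written so that no subtraction truncates.\<close>

definition cdist :: "nat \<Rightarrow> nat \<Rightarrow> nat \<Rightarrow> nat" where
  "cdist N i j = min (max i j - min i j) (N - (max i j - min i j))"

lemma cdist_commute: "cdist N i j = cdist N j i"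
  by (simp add: cdist_def max.commute min.commute)

lemma cdist_le_iff:
  assumes "i < N" "j < N"
  shows "cdist N i j \<le> k \<longleftrightarrow> i \<le> j + k \<and> j \<le> i + k \<or> N + i \<le> j + k \<or> N + j \<le> i + k"
  using assms by (cases "i \<le> j") (auto simp: cdist_def min_le_iff_disj)

lemma edge_cycle_iff:
  assumes "x < n" "y < n"
  shows "{x, y} \<in> cycle_edges n \<longleftrightarrow> y = Suc x mod n \<or> x = Suc y mod n"
  using assms by (auto simp: cycle_edges_def doubleton_eq_iff)

lemma Suc_mod_if: "x < n \<Longrightarrow> Suc x mod n = (if Suc x = n then 0 else Suc x)"
  by (auto simp: mod_Suc)

text \<open>The triangle inequality for a step along an edge, which makes the circular distance of the
  ends of a path a lower bound for its length.\<close>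

lemma cdist_edge:
  assumes "x < n" "y < n" "z < n" "{x, y} \<in> cycle_edges n"
  shows "cdist n x z \<le> Suc (cdist n y z)"
proof -
  have "y = (if Suc x = n then 0 else Suc x) \<or> x = (if Suc y = n then 0 else Suc y)"
    using assms edge_cycle_iff[of x n y] Suc_mod_if by auto
  moreover have "y \<le> z + cdist n y z \<and> z \<le> y + cdist n y z
      \<or> n + y \<le> z + cdist n y z \<or> n + z \<le> y + cdist n y z"
    using cdist_le_iff[of y n z "cdist n y z"] assms by simp
  ultimately show ?thesis
    using assms(1-3) unfolding cdist_le_iff[OF assms(1,3)] by (auto split: if_splits)
qed

lemma cdist_ends_le_path_length:
  assumes "successively (\<lambda>x y. {x, y} \<in> cycle_edges n) p" "p \<noteq> []" "set p \<subseteq> {..<n}"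
  shows "cdist n (hd p) (last p) \<le> length p - 1"
  using assms
proof (induction p)
  case (Cons x p)
  show ?case
  proof (cases "p = []")
    case True
    then show ?thesis by (simp add: cdist_def)
  next
    case False
    with Cons have "cdist n (hd p) (last p) \<le> length p - 1"
      by (simp add: successively_Cons)
    moreover have "cdist n x (last p) \<le> Suc (cdist n (hd p) (last p))"
      using Cons.prems False by (intro cdist_edge) (auto simp: successively_Cons subset_iff)
    ultimately show ?thesis
      using False by (cases p) auto
  qed
qed simp

text \<open>Walking forward from \<open>u\<close> for fewer than \<open>n\<close> steps visits no vertex twice. Such an arc, or
  the reverse of one, is a shortest path between any two vertices.\<close>

lemma is_path_arc:
  assumes "u < n" "k < n"
  shows "is_path (cycle_verts n) (cycle_edges n) u
    (map (\<lambda>t. (u + t) mod n) [0..<Suc k]) ((u + k) mod n)" (is "is_path _ _ _ ?p _")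
proof -
  have "inj_on (\<lambda>t. (u + t) mod n) {0..<Suc k}"
  proof (rule linorder_inj_onI)
    fix s t assume "s < t" "s \<in> {0..<Suc k}" "t \<in> {0..<Suc k}"
    then have "0 < t - s" "t - s < n" using assms by auto
    then have "\<not> n dvd (u + t) - (u + s)" using nat_dvd_not_less by simp
    then show "(u + s) mod n \<noteq> (u + t) mod n"
      using mod_eq_dvd_iff_nat[of "u + s" "u + t" n] \<open>s < t\<close> by auto
  qed auto
  then have "distinct ?p" by (simp add: distinct_map del: upt_Suc)
  moreover have "successively (\<lambda>x y. {x, y} \<in> cycle_edges n) ?p"
    using assms
    by (auto simp: successively_conv_nth edge_cycle_iff mod_Suc_eq simp del: upt_Suc)
  moreover have "hd ?p = u" using assms by (simp add: hd_map del: upt_Suc)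
  ultimately show ?thesis
    using assms by (auto simp: is_path_def cycle_verts_def)
qed

lemma is_path_rev:
  assumes "is_path V E u p v"
  shows "is_path V E v (rev p) u"
  using assms by (auto simp: is_path_def hd_rev last_rev insert_commute)

lemma vdist_cycle:
  assumes "u < n" "v < n"
  shows "vdist (cycle_verts n) (cycle_edges n) u v = enat (cdist n u v)"
proof (rule antisym)
  have "v = (u + cdist n u v) mod n \<or> u = (v + cdist n u v) mod n"
    using assms by (auto simp: cdist_def min_def max_def mod_if)
  moreover have "cdist n u v < n" using assms by (auto simp: cdist_def)
  ultimately obtain p where "is_path (cycle_verts n) (cycle_edges n) u p v"
    "length p = Suc (cdist n u v)"
    by (metis assms is_path_arc is_path_rev length_map length_rev length_upt minus_nat.diff_0)
  then show "vdist (cycle_verts n) (cycle_edges n) u v \<le> enat (cdist n u v)"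
    unfolding vdist_def by (intro INF_lower2[of p]) auto
next
  show "enat (cdist n u v) \<le> vdist (cycle_verts n) (cycle_edges n) u v"
    unfolding vdist_def
    by (rule INF_greatest) (use cdist_ends_le_path_length in \<open>auto simp: is_path_def cycle_verts_def\<close>)
qed

section \<open>Reduction to a coloring of points on a circle\<close>

definition cycle_elem :: "nat \<Rightarrow> nat \<Rightarrow> nat + nat set" where
  "cycle_elem n i = (if even i then Inl (i div 2) else Inr {i div 2, Suc (i div 2) mod n})"

lemma inj_on_cycle_elem:
  assumes "n \<ge> 3"
  shows "inj_on (cycle_elem n) {..<2 * n}"
proof (rule inj_onI)
  fix i j assume ij: "i \<in> {..<2 * n}" "j \<in> {..<2 * n}" "cycle_elem n i = cycle_elem n j"
  then have "i div 2 < n" "j div 2 < n" "even i \<longleftrightarrow> even j"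
    by (auto simp: cycle_elem_def split: if_splits)
  moreover from this have "i div 2 = j div 2"
    using ij(3) assms by (auto simp: cycle_elem_def doubleton_eq_iff Suc_mod_if split: if_splits)
  ultimately show "i = j" by (metis dvd_mult_div_cancel odd_two_times_div_two_succ)
qed

lemma cycle_elem_image: "cycle_elem n ` {..<2 * n} = cycle_verts n <+> cycle_edges n"
proof (rule antisym)
  show "cycle_elem n ` {..<2 * n} \<subseteq> cycle_verts n <+> cycle_edges n"
    by (auto simp: cycle_elem_def cycle_verts_def cycle_edges_def)
  have "Inl i \<in> cycle_elem n ` {..<2 * n}" if "i < n" for i
    using that by (intro image_eqI[of _ _ "2 * i"]) (auto simp: cycle_elem_def)
  moreover have "Inr {i, Suc i mod n} \<in> cycle_elem n ` {..<2 * n}" if "i < n" for i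
    using that by (intro image_eqI[of _ _ "Suc (2 * i)"]) (auto simp: cycle_elem_def)
  ultimately show "cycle_verts n <+> cycle_edges n \<subseteq> cycle_elem n ` {..<2 * n}"
    by (auto simp: cycle_verts_def cycle_edges_def)
qed

text \<open>The next four lemmas are the cases of the distance formula: two vertices, two edges, and a
  vertex and an edge. Doubling the number of points on the circle doubles all distances; the
  minima are those over the end vertices of the edges.\<close>

lemma cdist_double: "cdist (2 * n) (2 * u) (2 * v) = 2 * cdist n u v"
  by (auto simp: cdist_def min_def max_def)

lemma cdist_double_Suc: "cdist (2 * n) (Suc (2 * u)) (Suc (2 * v)) = 2 * cdist n u v"
  by (auto simp: cdist_def min_def max_def)

lemma cdist_vertex_edge:
  assumes "u < n" "v < n"
  shows "cdist (2 * n) (2 * u) (Suc (2 * v)) =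
    Suc (2 * min (cdist n u v) (cdist n u (Suc v mod n)))"
proof (cases "u \<le> v")
  case True
  then obtain d where d: "v = u + d" using le_Suc_ex by blast
  show ?thesis
    using assms unfolding d Suc_mod_if[OF assms(2)[unfolded d]]
    by (cases "Suc (u + d) = n") (auto simp: cdist_def min_def max_def)
next
  case False
  then obtain d where d: "u = Suc (v + d)" using less_imp_Suc_add by (metis not_le)
  then have "Suc v \<noteq> n" using assms by simp
  with assms show ?thesis unfolding d
    by (auto simp: cdist_def min_def max_def)
qed

lemma cdist_edge_edge:
  assumes "u < n" "v < n" "u \<noteq> v"
  shows "Suc (min (min (cdist n u v) (cdist n u (Suc v mod n)))
      (min (cdist n (Suc u mod n) v) (cdist n (Suc u mod n) (Suc v mod n)))) = cdist n u v"
proof -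
  \<comment> \<open>Both sides are symmetric in \<open>u\<close> and \<open>v\<close>.\<close>
  have *: "Suc (min (min (cdist n u v) (cdist n u (Suc v mod n)))
      (min (cdist n (Suc u mod n) v) (cdist n (Suc u mod n) (Suc v mod n)))) = cdist n u v"
    if less: "u < v" "v < n" for u v
  proof -
    obtain d where d: "v = Suc (u + d)" using less(1) less_imp_Suc_add by blast
    obtain k where n: "n = Suc (v + k)" using less(2) less_imp_Suc_add by blast
    define e where "e = u + k"
    have Suc_u: "Suc u mod n = Suc u" using less by simp
    have Suc_v: "Suc v mod n = (if k = 0 then 0 else Suc v)" by (simp add: n)
    \<comment> \<open>The arcs between the two edges have \<open>d\<close> and \<open>e\<close> edges.\<close>
    have "cdist n u v = min (Suc d) (Suc e)"
      "cdist n u (Suc v mod n) = min (Suc (Suc d)) e"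
      "cdist n (Suc u mod n) v = min d (Suc (Suc e))"
      "cdist n (Suc u mod n) (Suc v mod n) = min (Suc d) (Suc e)"
      unfolding Suc_u Suc_v by (simp_all add: cdist_def n d e_def min.commute add.commute)
    then show ?thesis by (simp add: min_def)
  qed
  show ?thesis
  proof (cases "u < v")
    case False
    with assms have "v < u" by simp
    from *[OF this assms(1)] show ?thesis
      by (simp only: cdist_commute[of n v] cdist_commute[of n "Suc v mod n"]
          min.assoc min.left_commute)
  qed (use * assms in blast)
qed

lemma tdist_cycle_elem:
  assumes "i < 2 * n" "j < 2 * n" "i \<noteq> j"
  shows "tdist (cycle_verts n) (cycle_edges n) (cycle_elem n i) (cycle_elem n j) =
    enat ((cdist (2 * n) i j + 1) div 2)"
proof -
  define u v where "u = i div 2" and "v = j div 2"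
  have uv: "u < n" "v < n" "Suc u mod n < n" "Suc v mod n < n"
    using assms by (auto simp: u_def v_def)
  have "i = 2 * u \<or> i = Suc (2 * u)" "j = 2 * v \<or> j = Suc (2 * v)"
    unfolding u_def v_def by presburger+
  then consider "i = 2 * u" "j = 2 * v" | "i = 2 * u" "j = Suc (2 * v)"
    | "i = Suc (2 * u)" "j = 2 * v" | "i = Suc (2 * u)" "j = Suc (2 * v)"
    by blast
  then show ?thesis
  proof cases
    case 1
    then show ?thesis using uv by (simp add: cycle_elem_def vdist_cycle cdist_double)
  next
    case 2
    then show ?thesis using uv
      by (simp add: cycle_elem_def vdist_cycle cdist_vertex_edge inf_min one_enat_def)
  next
    case 3
    then show ?thesis using uv
      by (simp add: cycle_elem_def vdist_cycle cdist_commute[of "2 * n" "Suc _"] cdist_vertex_edge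
          inf_min one_enat_def)
  next
    case 4
    then have "u \<noteq> v" using assms by auto
    with 4 uv show ?thesis
      by (simp add: cycle_elem_def vdist_cycle cdist_double_Suc cdist_edge_edge
          inf_min one_enat_def)
  qed
qed

text \<open>The factor 2 absorbs the rounding: \<open>\<lceil>d / 2\<rceil> > s\<close> is equivalent to \<open>d > 2s\<close>.\<close>

definition cyclic_coloring :: "(nat \<Rightarrow> nat) \<Rightarrow> nat \<Rightarrow> nat \<Rightarrow> (nat \<Rightarrow> nat) \<Rightarrow> bool" where
  "cyclic_coloring S N k f \<longleftrightarrow>
     (\<forall>i<N. f i \<in> {1..k}) \<and>
     (\<forall>i<N. \<forall>j<N. i \<noteq> j \<and> f i = f j \<longrightarrow> 2 * S (f i) < cdist N i j)"

lemma packing_total_coloring_cycle_iff: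
  assumes "n \<ge> 3"
  shows "packing_total_coloring S (cycle_verts n) (cycle_edges n) k c \<longleftrightarrow>
    cyclic_coloring S (2 * n) k (c \<circ> cycle_elem n)"
proof -
  have "enat (S a) < tdist (cycle_verts n) (cycle_edges n) (cycle_elem n i) (cycle_elem n j) \<longleftrightarrow>
      2 * S a < cdist (2 * n) i j" if "i < 2 * n" "j < 2 * n" "i \<noteq> j" for i j a
    using that by (auto simp: tdist_cycle_elem)
  then show ?thesis
    unfolding packing_total_coloring_def cyclic_coloring_def cycle_elem_image[symmetric]
    using inj_on_eq_iff[OF inj_on_cycle_elem[OF assms]] by auto
qed

lemma ex_packing_total_coloring_cycle_iff:
  assumes "n \<ge> 3"
  shows "(\<exists>c. packing_total_coloring S (cycle_verts n) (cycle_edges n) k c) \<longleftrightarrow>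
    (\<exists>f. cyclic_coloring S (2 * n) k f)"
proof
  assume "\<exists>f. cyclic_coloring S (2 * n) k f"
  then obtain f where "cyclic_coloring S (2 * n) k f" ..
  then have "cyclic_coloring S (2 * n) k ((f \<circ> the_inv_into {..<2 * n} (cycle_elem n)) \<circ> cycle_elem n)"
    using the_inv_into_f_f[OF inj_on_cycle_elem[OF assms]] by (simp add: cyclic_coloring_def)
  then show "\<exists>c. packing_total_coloring S (cycle_verts n) (cycle_edges n) k c"
    using packing_total_coloring_cycle_iff[OF assms] by blast
qed (use packing_total_coloring_cycle_iff[OF assms] in blast)

section \<open>The lower bound\<close>

text \<open>The arcs of length \<open>g\<close> that start at the points of \<open>A\<close> are disjoint, so together they
  have \<open>g\<close> times as many points as \<open>A\<close>, all of them on a circle of \<open>N\<close> points.\<close>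

lemma card_spread_le:
  assumes "A \<subseteq> {..<N}" "0 < g" "g \<le> N"
    and spread: "\<And>i j. i \<in> A \<Longrightarrow> j \<in> A \<Longrightarrow> i \<noteq> j \<Longrightarrow> g \<le> cdist N i j"
  shows "card A \<le> N div g"
proof -
  let ?h = "\<lambda>(i, t). (i + t) mod N"
  have "inj_on ?h (A \<times> {..<g})"
  proof (rule inj_onI, clarsimp)
    fix i s j t
    assume *: "i \<in> A" "j \<in> A" "s < g" "t < g" "(i + s) mod N = (j + t) mod N"
    have lt: "i < N" "j < N" using * assms(1) by auto
    have "i = j"
      using spread[of i j] *(3-) lt assms(3)
      by (cases "i = j") (auto simp: *(1,2) cdist_def min_def max_def mod_if split: if_splits)
    moreover from this have "s = t"
      using *(3-) lt assms(3) by (auto simp: mod_if split: if_splits)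
    ultimately show "i = j \<and> s = t" ..
  qed
  moreover have "?h ` (A \<times> {..<g}) \<subseteq> {..<N}"
    using assms(1) by (auto intro!: mod_less_divisor)
  ultimately have "card (A \<times> {..<g}) \<le> card {..<N}"
    by (meson card_inj_on_le finite_lessThan)
  then have "card A * g \<le> N" by (simp add: card_cartesian_product)
  with \<open>0 < g\<close> show ?thesis by (simp add: less_eq_div_iff_mult_less_eq)
qed

text \<open>Each of the colors 1 and 2 is spread with gaps of at least 3, each of the \<open>k - 2\<close>
  others with gaps of at least 5. For \<open>k < 2\<close> the truncated bound still holds.\<close>

lemma length_le_of_cyclic_coloring:
  assumes S: "S 1 = 1" "S 2 = 1" "\<And>i. i \<ge> 3 \<Longrightarrow> S i = (2 :: nat)"
    and "N \<ge> 5" "cyclic_coloring S N k f"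
  shows "N \<le> 2 * (N div 3) + (k - 2) * (N div 5)"
proof -
  define C where "C a = {i. i < N \<and> f i = a}" for a
  have C: "card (C a) \<le> N div (2 * S a + 1)" if "2 * S a + 1 \<le> N" for a
  proof (rule card_spread_le)
    show "2 * S a + 1 \<le> cdist N i j" if "i \<in> C a" "j \<in> C a" "i \<noteq> j" for i j
      using that assms(5) by (simp add: C_def cyclic_coloring_def Suc_le_eq) metis
  qed (use that in \<open>auto simp: C_def\<close>)
  have "{..<N} \<subseteq> (\<Union>a\<in>{1, 2} \<union> {3..k}. C a)"
  proof
    fix i assume "i \<in> {..<N}"
    then have *: "i \<in> C (f i)" "f i \<in> {1..k}"
      using assms(5) by (auto simp: C_def cyclic_coloring_def)
    then have "f i \<in> {1, 2} \<union> {3..k}" by auto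
    then show "i \<in> (\<Union>a\<in>{1, 2} \<union> {3..k}. C a)" using *(1) by (rule UN_I)
  qed
  then have "card {..<N} \<le> card (\<Union>a\<in>{1, 2} \<union> {3..k}. C a)"
    by (rule card_mono[rotated]) (auto simp: C_def)
  also have "\<dots> \<le> (\<Sum>a\<in>{1, 2} \<union> {3..k}. card (C a))"
    by (rule card_UN_le) simp
  also have "\<dots> = card (C 1) + card (C 2) + (\<Sum>a\<in>{3..k}. card (C a))"
    by (subst sum.union_disjoint) auto
  also have "\<dots> \<le> N div 3 + N div 3 + (\<Sum>a\<in>{3..k}. N div 5)"
  proof (intro add_mono sum_mono)
    show "card (C 1) \<le> N div 3" "card (C 2) \<le> N div 3"
      using C[of 1] C[of 2] S(1,2) \<open>N \<ge> 5\<close> by simp_all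
    show "card (C a) \<le> N div 5" if "a \<in> {3..k}" for a
      using C[of a] S(3)[of a] that \<open>N \<ge> 5\<close> by simp
  qed
  finally show ?thesis by (simp add: mult_2)
qed

section \<open>Colorings from words\<close>

text \<open>The linear counterpart of the coloring condition. It has a recursion along the list
  (\<open>spaced_Cons\<close>), so that the simplifier can check concrete words and extend a word by a block.\<close>

definition spaced :: "nat list \<Rightarrow> bool" where
  "spaced w \<longleftrightarrow> (\<forall>i j. i < j \<and> j < length w \<and> w ! i = w ! j \<longrightarrow>
     (if w ! i \<le> 2 then 2 else 4) < j - i)"

lemma spaced_Nil [simp]: "spaced []"
  by (simp add: spaced_def)

lemma spaced_Cons [simp]:
  "spaced (x # w) \<longleftrightarrow> x \<notin> set (take (if x \<le> 2 then 2 else 4) w) \<and> spaced w"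
proof -
  have "spaced (x # w) \<longleftrightarrow>
      (\<forall>j. j < length w \<and> x = w ! j \<longrightarrow> (if x \<le> 2 then 2 else 4) < Suc j) \<and> spaced w"
    (is "?L \<longleftrightarrow> ?R")
  proof
    assume L: ?L
    show ?R
      unfolding spaced_def
    proof (intro conjI allI impI)
      fix j assume "j < length w \<and> x = w ! j"
      then show "(if x \<le> 2 then 2 else 4) < Suc j"
        using L[unfolded spaced_def, rule_format, of 0 "Suc j"] by simp
    next
      fix i j assume "i < j \<and> j < length w \<and> w ! i = w ! j"
      then show "(if w ! i \<le> 2 then 2 else 4) < j - i"
        using L[unfolded spaced_def, rule_format, of "Suc i" "Suc j"] by simp
    qed
  next
    assume R: ?R
    show ?L
      unfolding spaced_def
    proof (intro allI impI)
      fix i j assume "i < j \<and> j < length (x # w) \<and> (x # w) ! i = (x # w) ! j"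
      then show "(if (x # w) ! i \<le> 2 then 2 else 4) < j - i"
        using R by (cases i; cases j) (auto simp: spaced_def)
    qed
  qed
  also have "(\<forall>j. j < length w \<and> x = w ! j \<longrightarrow> m < Suc j) \<longleftrightarrow> x \<notin> set (take m w)" for m
    by (auto simp: in_set_conv_nth less_Suc_eq_le) (metis leI)
  finally show ?thesis .
qed

text \<open>No constraint reaches further than 4 steps, so closing a word up to a circle creates only
  conflicts that are already visible when its first 4 letters are repeated at its end.\<close>

lemma cyclic_coloring_of_spaced:
  assumes S: "S 1 = 1" "S 2 = 1" "\<And>i. i \<ge> 3 \<Longrightarrow> S i = (2 :: nat)"
    and w: "length w = N" "N \<ge> 4" "set w \<subseteq> {1..k}" "spaced (w @ take 4 w)"
  shows "cyclic_coloring S N k (nth w)"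
proof -
  define r where "r a = (if a \<le> 2 then 2 else 4 :: nat)" for a :: nat
  have r: "r a \<le> 4" for a by (simp add: r_def)
  have range: "w ! i \<in> {1..k}" if "i < N" for i
    using that w by (metis nth_mem subsetD)
  have "2 * S a = r a" if "a \<ge> 1" for a
    using that S by (cases "a = 1 \<or> a = 2") (auto simp: r_def)
  then have rS: "2 * S (w ! i) = r (w ! i)" if "i < N" for i
    using range[OF that] by auto
  have nth1: "(w @ take 4 w) ! i = w ! i" if "i < N" for i
    using that w by (simp add: nth_append)
  have nth2: "(w @ take 4 w) ! (N + i) = w ! i" if "i < 4" for i
    using that w by (simp add: nth_append)
  have sp: "r ((w @ take 4 w) ! i) < j - i"
    if "i < j" "j < N + 4" "(w @ take 4 w) ! i = (w @ take 4 w) ! j" for i j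
    using that w unfolding spaced_def r_def by simp
  have main: "r (w ! i) < cdist N i j" if "i < j" "j < N" "w ! i = w ! j" for i j
  proof -
    have "r (w ! i) < j - i" using sp[of i j] that by (simp add: nth1)
    \<comment> \<open>The way from \<open>j\<close> around the circle to \<open>i\<close> leads into the repeated letters, or is longer than 4.\<close>
    moreover have "r (w ! i) < N + i - j"
    proof (cases "i < 4")
      case True
      then show ?thesis using sp[of j "N + i"] that by (simp add: nth1 nth2)
    next
      case False
      then show ?thesis using r[of "w ! i"] that by linarith
    qed
    ultimately show ?thesis using that by (auto simp: cdist_def)
  qed
  have "2 * S (w ! i) < cdist N i j" if "i < N" "j < N" "i \<noteq> j" "w ! i = w ! j" for i j
    using main[of i j] main[of j i] that by (cases "i < j") (auto simp: rS cdist_commute)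
  then show ?thesis using range by (simp add: cyclic_coloring_def)
qed

text \<open>The induction prepends blocks. Whether a block fits in front of a word depends only on the
  first 4 letters of that word, and these are always 1231.\<close>

lemma spaced_blocks:
  "spaced (concat (replicate a [1,2,3,1,2,4]) @ concat (replicate b [1,2,3,1,4,2,1,3,2,4])
     @ [1,2,3,1])"
  (is "spaced (?A a @ ?B b @ _)")
proof -
  define good where "good u \<longleftrightarrow> spaced u \<and> (\<exists>v. u = 1 # 2 # 3 # 1 # v)" for u :: "nat list"
  have A_step: "good ([1,2,3,1,2,4] @ u)" and B_step: "good ([1,2,3,1,4,2,1,3,2,4] @ u)"
    if "good u" for u
    using that by (auto simp: good_def numeral_eq_Suc)
  have "good [1,2,3,1]"
    by (simp add: good_def)
  then have B: "good (?B b @ [1,2,3,1])"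
    by (induction b) (use B_step in simp_all)
  have "good (?A a @ ?B b @ [1,2,3,1])"
    by (induction a) (use B A_step in simp_all)
  then show ?thesis by (simp add: good_def)
qed

text \<open>The number \<open>b\<close> of long blocks is the least one with \<open>n - 5b\<close> divisible by 3. Then \<open>5b \<le> n\<close>
  fails only for 4 and 7 (where \<open>b = 2\<close>) among the numbers from 3 on.\<close>

lemma cyclic_4_coloring:
  assumes S: "S 1 = 1" "S 2 = 1" "\<And>i. i \<ge> 3 \<Longrightarrow> S i = (2 :: nat)"
    and "n \<ge> 3" "n \<notin> {4, 7}"
  shows "\<exists>f. cyclic_coloring S (2 * n) 4 f"
proof -
  define b where "b = (if n mod 3 = 0 then 0 else if n mod 3 = 1 then 2 else 1 :: nat)"
  define a where "a = (n - 5 * b) div 3"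
  have n: "n = 3 * a + 5 * b"
    using assms(4,5) unfolding a_def b_def by (auto split: if_splits; presburger)
  define w :: "nat list" where
    "w = concat (replicate a [1,2,3,1,2,4]) @ concat (replicate b [1,2,3,1,4,2,1,3,2,4])"
  have "take 4 w = [1,2,3,1]"
    using n \<open>n \<ge> 3\<close> by (cases a; cases b) (auto simp: w_def)
  then have "spaced (w @ take 4 w)"
    using spaced_blocks by (simp add: w_def)
  moreover have "length w = 2 * n"
    by (simp add: w_def length_concat sum_list_replicate n)
  moreover have "set w \<subseteq> {1..4}"
    by (auto simp: w_def)
  ultimately show ?thesis
    using cyclic_coloring_of_spaced[OF S] \<open>n \<ge> 3\<close> by fastforce
qed

section \<open>The chromatic number\<close>

lemma chromatic_number_eqI:
  assumes "\<exists>c. packing_total_coloring S V E m c"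
    and "\<And>k c. packing_total_coloring S V E k c \<Longrightarrow> m \<le> k"
  shows "packing_total_chromatic_number S V E = enat m"
  unfolding packing_total_chromatic_number_def
  using assms by (intro antisym INF_lower2[of m] INF_greatest) auto

theorem proposition14:
  fixes S :: "nat \<Rightarrow> nat" and n :: nat
  assumes "S 1 = 1" and "S 2 = 1" and "\<And>i. i \<ge> 3 \<Longrightarrow> S i = 2"
    and "n \<ge> 3"
  shows "packing_total_chromatic_number S (cycle_verts n) (cycle_edges n) =
    (if n \<notin> {4, 7} then 4 else if n = 7 then 5 else 6)"
proof -
  define m :: nat where "m = (if n \<notin> {4, 7} then 4 else if n = 7 then 5 else 6)"
  have "\<exists>f. cyclic_coloring S (2 * n) m f"
  proof (cases "n \<in> {4, 7}")
    case True
    moreover have "cyclic_coloring S 8 6 (nth [1,2,3,1,2,4,5,6])"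
      by (rule cyclic_coloring_of_spaced[OF assms(1-3)]) (auto simp: numeral_eq_Suc)
    moreover have "cyclic_coloring S 14 5 (nth [1,2,3,1,2,4,1,2,5,1,2,3,4,5])"
      by (rule cyclic_coloring_of_spaced[OF assms(1-3)]) (auto simp: numeral_eq_Suc)
    ultimately show ?thesis by (auto simp: m_def)
  qed (use cyclic_4_coloring assms in \<open>auto simp: m_def\<close>)
  moreover have "m \<le> k" if "cyclic_coloring S (2 * n) k f" for k f
  proof (rule ccontr)
    assume "\<not> m \<le> k"
    \<comment> \<open>Even with \<open>m - 1\<close> colors the counting bound would have to hold.\<close>
    then have "(k - 2) * (2 * n div 5) \<le> (m - 3) * (2 * n div 5)"
      by (intro mult_right_mono) auto
    then have "2 * n \<le> 2 * (2 * n div 3) + (m - 3) * (2 * n div 5)"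
      using length_le_of_cyclic_coloring[OF assms(1-3) _ that] \<open>n \<ge> 3\<close> by linarith
    then show False
      using \<open>n \<ge> 3\<close> by (auto simp: m_def split: if_splits; linarith)
  qed
  ultimately have "packing_total_chromatic_number S (cycle_verts n) (cycle_edges n) = enat m"
    using ex_packing_total_coloring_cycle_iff[OF assms(4)] by (intro chromatic_number_eqI) blast+
  then show ?thesis by (auto simp: m_def numeral_eq_enat)
qed

end
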